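(* Let $n\ge 2$, let $X$ be a smooth vector field on $\mathbb{H}^n$, let $\lambda,\rho\in\mathbb{R}$, and let $G:\mathbb{H}^n\to\mathbb{R}$ be a smooth nowhere vanishing function. Then $(\mathbb{H}^n,ds^2,X,\lambda,\rho)$ is a $G$-Ricci-Bourguignon soliton if and only if there exist a smooth function $f:\mathbb{R}^{n-1}\to\mathbb{R}$, $f=f(x_1,\dots,x_{n-1})$, and, for each $k\in\{1,\dots,n-1\}$, a smooth function $h_k=h_k(x_1,\dots,x_{k-1},\widehat{x}_k,x_{k+1},\dots,x_n)$ of the variables $x_j$ with $j\ne k$ (with $x_n>0$), such that \begin{align*} X&=\sum_{k=1}^{n-1}\left(\int f\,dx_k\right)\frac{\partial}{\partial x_k} +(\lambda+(n-1)(1-n\rho))\sum_{k=1}^{n-1}\left(\int\left(\int\frac{dx_n}{x_nG}\right)dx_k\right)\frac{\partial}{\partial x_k}\\ &\quad+(\lambda+(n-1)(1-n\rho))\sum_{k=1}^{n-1}\left(\int\frac{dx_k}{G}\right)\frac{\partial}{\partial x_k} +\sum_{k=1}^{n-1}h_k\frac{\partial}{\partial x_k}\\ &\quad+\left(f\,x_n+(\lambda+(n-1)(1-n\rho))\,x_n\int\frac{dx_n}{x_nG}\right)\frac{\partial}{\partial x_n} \end{align*} and the following constraints hold on $\mathbb{H}^n$: (i) for all $k\in\{1,\dots,n-1\}$, \[ \frac{\partial h_k}{\partial x_n}=-x_n\frac{\partial f}{\partial x_k}+(-\lambda+(n-1)(n\rho-1))\left(\frac{\partial}{\partial x_k}\left(x_n\int\frac{dx_n}{x_nG}\right)+\frac{\partial}{\partial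 x_n}\left(\int\left(\int\frac{dx_n}{x_nG}\right)dx_k+\int\frac{dx_k}{G}\right)\right); \] (ii) for all $k,j\in\{1,\dots,n-1\}$ with $k\neq j$, \begin{align*} &\frac{\partial}{\partial x_j}\left(\int f\,dx_k\right)+\frac{\partial}{\partial x_k}\left(\int f\,dx_j\right)+\frac{\partial h_k}{\partial x_j}+\frac{\partial h_j}{\partial x_k}\\ &=(-\lambda+(n-1)(n\rho-1))\,\frac{\partial}{\partial x_j}\left(\int\frac{dx_k}{G}+\int\left(\int\frac{dx_n}{x_nG}\right)dx_k\right)\\ &\quad+(-\lambda+(n-1)(n\rho-1))\,\frac{\partial}{\partial x_k}\left(\int\frac{dx_j}{G}+\int\left(\int\frac{dx_n}{x_nG}\right)dx_j\right). \end{align*}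
   Context: $\mathbb{H}^n=\{(x_1,\dots,x_n)\in\mathbb{R}^n : x_n>0\}$ with the hyperbolic metric $ds^2=\frac{dx_1^2+\cdots+dx_n^2}{x_n^2}$. For a Riemannian manifold $(M,g)$ with Ricci tensor $\mathrm{Ric}$ and scalar curvature $S$, a smooth vector field $X$, real constants $\lambda,\rho$ and a smooth nowhere vanishing function $G$, the manifold is called a $G$-Ricci-Bourguignon soliton if $\mathrm{Ric}+\frac{G}{2}\mathcal{L}_Xg=(\lambda+\rho S)g$, where $\mathcal{L}_X$ is the Lie derivative. (On $\mathbb{H}^n$, $\mathrm{Ric}=-(n-1)ds^2$ and $S=-n(n-1)$.) The hat $\widehat{x}_k$ means that the variable $x_k$ is omitted. Integral signs without bounds denote smooth antiderivatives in the indicated variable (the other variables being parameters), chosen once and for all; the same choice is used at every occurrence of the same expression. $G$ is evaluated at $(x_1,\dots,x_n)$ and $f$ at $(x_1,\dots,x_{n-1})$. *)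

theory Defs
  imports "HOL-Analysis.Analysis"
begin

text \<open>Smoothness, intended for open \<open>S\<close>: directional derivatives of every order exist in all
  directions and are again Frechet differentiable on \<open>S\<close>.\<close>

fun times_differentiable_on ::
    "nat \<Rightarrow> 'a::real_normed_vector set \<Rightarrow> ('a \<Rightarrow> 'b::real_normed_vector) \<Rightarrow> bool" where
  "times_differentiable_on 0 S f \<longleftrightarrow> continuous_on S f"
| "times_differentiable_on (Suc m) S f \<longleftrightarrow>
     (\<forall>x\<in>S. f differentiable (at x)) \<and>
     (\<forall>v. times_differentiable_on m S (\<lambda>x. frechet_derivative f (at x) v))"

definition smooth_on :: "'a::real_normed_vector set \<Rightarrow> ('a \<Rightarrow> 'b::real_normed_vector) \<Rightarrow> bool" where
  "smooth_on S f \<longleftrightarrow> (\<forall>m. times_differentiable_on m S f)"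

text \<open>Meaningful only where \<open>f\<close> is differentiable.\<close>

definition partial :: "'n::finite \<Rightarrow> (real^'n \<Rightarrow> real) \<Rightarrow> real^'n \<Rightarrow> real" where
  "partial i f x = frechet_derivative f (at x) (axis i 1)"

definition antiderivative_on ::
    "(real^'n::finite) set \<Rightarrow> 'n \<Rightarrow> (real^'n \<Rightarrow> real) \<Rightarrow> (real^'n \<Rightarrow> real) \<Rightarrow> bool" where
  "antiderivative_on S i u U \<longleftrightarrow> smooth_on S U \<and> (\<forall>x\<in>S. partial i U x = u x)"

definition indep_of_var_on :: "(real^'n::finite) set \<Rightarrow> 'n \<Rightarrow> (real^'n \<Rightarrow> 'b) \<Rightarrow> bool" where
  "indep_of_var_on S i u \<longleftrightarrow>
     (\<forall>x\<in>S. \<forall>y\<in>S. (\<forall>j. j \<noteq> i \<longrightarrow> x $ j = y $ j) \<longrightarrow> u x = u y)"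

text \<open>Riemannian geometry of an open subset of Euclidean space, in the global coordinates;
  a symmetric 2-tensor field is given by its matrix of components.\<close>

definition riemannian_metric_on :: "(real^'n::finite) set \<Rightarrow> (real^'n \<Rightarrow> real^'n^'n) \<Rightarrow> bool" where
  "riemannian_metric_on M g \<longleftrightarrow>
     smooth_on M g \<and>
     (\<forall>x\<in>M. transpose (g x) = g x \<and> (\<forall>v. v \<noteq> 0 \<longrightarrow> v \<bullet> (g x *v v) > 0))"

text \<open>\<open>christoffel g k i j\<close> has upper index \<open>k\<close> and lower indices \<open>i\<close>, \<open>j\<close>.\<close>

definition christoffel ::
    "(real^'n::finite \<Rightarrow> real^'n^'n) \<Rightarrow> 'n \<Rightarrow> 'n \<Rightarrow> 'n \<Rightarrow> real^'n \<Rightarrow> real" where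
  "christoffel g k i j x =
     (1/2) * (\<Sum>l\<in>UNIV. matrix_inv (g x) $ k $ l *
        (partial i (\<lambda>y. g y $ j $ l) x + partial j (\<lambda>y. g y $ i $ l) x
         - partial l (\<lambda>y. g y $ i $ j) x))"

text \<open>\<open>riemann g l k i j\<close> is the \<open>l\<close>-th component of \<open>R(\<partial>\<^sub>i, \<partial>\<^sub>j)\<partial>\<^sub>k\<close>, where
  \<open>R(U, V) = \<nabla>\<^sub>U \<nabla>\<^sub>V - \<nabla>\<^sub>V \<nabla>\<^sub>U - \<nabla>\<^bsub>[U, V]\<^esub>\<close>; the Ricci tensor is \<open>Ric(V, W) = tr (U \<mapsto> R(U, V)W)\<close>.\<close>

definition riemann ::
    "(real^'n::finite \<Rightarrow> real^'n^'n) \<Rightarrow> 'n \<Rightarrow> 'n \<Rightarrow> 'n \<Rightarrow> 'n \<Rightarrow> real^'n \<Rightarrow> real" where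
  "riemann g l k i j x =
     partial i (christoffel g l j k) x - partial j (christoffel g l i k) x
     + (\<Sum>m\<in>UNIV. christoffel g l i m x * christoffel g m j k x
                  - christoffel g l j m x * christoffel g m i k x)"

definition ricci :: "(real^'n::finite \<Rightarrow> real^'n^'n) \<Rightarrow> real^'n \<Rightarrow> real^'n^'n" where
  "ricci g x = (\<chi> j k. \<Sum>i\<in>UNIV. riemann g i k i j x)"

definition scalar_curvature :: "(real^'n::finite \<Rightarrow> real^'n^'n) \<Rightarrow> real^'n \<Rightarrow> real" where
  "scalar_curvature g x = (\<Sum>i\<in>UNIV. \<Sum>j\<in>UNIV. matrix_inv (g x) $ i $ j * ricci g x $ i $ j)"

definition lie_derivative ::
    "(real^'n::finite \<Rightarrow> real^'n) \<Rightarrow> (real^'n \<Rightarrow> real^'n^'n) \<Rightarrow> real^'n \<Rightarrow> real^'n^'n" where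
  "lie_derivative X g x =
     (\<chi> i j. \<Sum>k\<in>UNIV. X x $ k * partial k (\<lambda>y. g y $ i $ j) x
                     + g x $ k $ j * partial i (\<lambda>y. X y $ k) x
                     + g x $ i $ k * partial j (\<lambda>y. X y $ k) x)"

definition G_ricci_bourguignon_soliton ::
    "(real^'n::finite) set \<Rightarrow> (real^'n \<Rightarrow> real^'n^'n) \<Rightarrow> (real^'n \<Rightarrow> real^'n) \<Rightarrow>
     real \<Rightarrow> real \<Rightarrow> (real^'n \<Rightarrow> real) \<Rightarrow> bool" where
  "G_ricci_bourguignon_soliton M g X lam rho G \<longleftrightarrow>
     open M \<and> riemannian_metric_on M g \<and> smooth_on M X \<and>
     smooth_on M G \<and> (\<forall>x\<in>M. G x \<noteq> 0) \<and>
     (\<forall>x\<in>M. ricci g x + (G x / 2) *\<^sub>R lie_derivative X g x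
            = (lam + rho * scalar_curvature g x) *\<^sub>R g x)"

text \<open>For \<open>n \<ge> 2\<close>, the space of \<open>n\<close>-tuples is \<open>real^'m option\<close> with \<open>CARD('m) = n - 1\<close>:
  the index \<open>None\<close> stands for the last coordinate and \<open>Some k\<close> for the others, so that functions of
  the first \<open>n - 1\<close> variables live on \<open>real^'m\<close>. As types are nonempty, \<open>n\<close> ranges over exactly the
  integers \<open>\<ge> 2\<close>.\<close>

definition upper_half_space :: "(real^'m::finite option) set" where
  "upper_half_space = {x. x $ None > 0}"

definition hyperbolic_metric :: "real^'m::finite option \<Rightarrow> real^'m option^'m option" where
  "hyperbolic_metric x = mat (1 / (x $ None)\<^sup>2)"

definition first_coords :: "real^'m::finite option \<Rightarrow> real^'m" where
  "first_coords x = (\<chi> k. x $ Some k)"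

end

theory Submission imports Defs begin

text \<open>Write \<open>x\<^sub>n\<close> for the last coordinate, which has index \<open>None\<close>, and
  \<open>c = \<lambda> + (n - 1) (1 - n \<rho>)\<close>. The hyperbolic metric is \<open>\<delta> / x\<^sub>n\<^sup>2\<close> and has constant
  curvature \<open>- 1\<close>, so its Ricci tensor is \<open>- (n - 1)\<close> times the metric and its scalar curvature is
  \<open>- n (n - 1)\<close>. Hence all terms of the soliton equation other than the Lie derivative are
  multiples of the metric, and together they give \<open>(G / 2) L\<^sub>X g = c g\<close>. By the product rule
  \<open>L\<^sub>X g = (L\<^sub>X \<delta> - 2 (X\<^sub>n / x\<^sub>n) \<delta>) / x\<^sub>n\<^sup>2\<close>. Thus the soliton equation is the linear
  first-order system
  \<open>\<partial>\<^sub>i X\<^sub>j + \<partial>\<^sub>j X\<^sub>i = 2 (X\<^sub>n / x\<^sub>n + c / G) \<delta>\<^sub>i\<^sub>j\<close>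
  (lemma \<open>soliton_iff_flat_conformal_killing\<close>).

  The diagonal equations of this system are integrated one variable at a time. The last one is
  \<open>\<partial>\<^sub>n (X\<^sub>n / x\<^sub>n) = c / (x\<^sub>n G)\<close>, with solutions \<open>X\<^sub>n = x\<^sub>n (f + c P)\<close> where \<open>f\<close> does not
  depend on \<open>x\<^sub>n\<close>; then \<open>\<partial>\<^sub>k X\<^sub>k = f + c P + c / G\<close> determines \<open>X\<^sub>k\<close> up to a function
  \<open>h\<^sub>k\<close> that does not depend on \<open>x\<^sub>k\<close>. This gives the form of \<open>X\<close>
  (lemma \<open>flat_conformal_killing_imp_primitives\<close>). For a field of this form, the off-diagonal
  equations are precisely the two families of constraints
  (lemma \<open>flat_conformal_killing_iff_constraints\<close>).\<close>

section \<open>Calculus of smooth functions\<close>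

lemma times_differentiable_on_cong:
  assumes "open S" "\<And>x. x \<in> S \<Longrightarrow> f x = g x" "times_differentiable_on m S f"
  shows "times_differentiable_on m S g"
  using assms(2,3)
proof (induction m arbitrary: f g)
  case 0
  then show ?case by (simp cong: continuous_on_cong)
next
  case (Suc m)
  have D: "(g has_derivative frechet_derivative f (at x)) (at x)" if "x \<in> S" for x
  proof -
    have "(f has_derivative frechet_derivative f (at x)) (at x)"
      using Suc.prems(2) that by (simp flip: frechet_derivative_works)
    then show ?thesis
      using has_derivative_transform_within_open[OF _ assms(1) that] Suc.prems(1) by blast
  qed
  have "times_differentiable_on m S (\<lambda>x. frechet_derivative g (at x) v)" for v
  proof (rule Suc.IH)
    show "frechet_derivative f (at x) v = frechet_derivative g (at x) v" if "x \<in> S" for x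
      using frechet_derivative_at[OF D[OF that]] by simp
    show "times_differentiable_on m S (\<lambda>x. frechet_derivative f (at x) v)"
      using Suc.prems(2) by simp
  qed
  then show ?case using D by (auto simp: differentiable_def)
qed

text \<open>An induction on the order needs only one computation of the first derivative, provided that
  the directional derivatives stay in the class of functions under consideration.\<close>

lemma times_differentiable_on_SucI:
  assumes "open S" "\<And>x. x \<in> S \<Longrightarrow> (f has_derivative f' x) (at x)"
    and "\<And>v. times_differentiable_on m S (\<lambda>x. f' x v)"
  shows "times_differentiable_on (Suc m) S f"
proof -
  have "times_differentiable_on m S (\<lambda>x. frechet_derivative f (at x) v)" for v
    using frechet_derivative_at[OF assms(2)]
    by (intro times_differentiable_on_cong[OF assms(1) _ assms(3)[of v]]) metis
  then show ?thesis using assms(2) by (auto simp: differentiable_def)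
qed

lemma smooth_on_differentiable: "smooth_on S f \<Longrightarrow> x \<in> S \<Longrightarrow> f differentiable (at x)"
  unfolding smooth_on_def by (metis times_differentiable_on.simps(2))

lemma times_differentiable_on_Suc_has_derivative:
  "times_differentiable_on (Suc m) S f \<Longrightarrow> x \<in> S \<Longrightarrow>
     (f has_derivative frechet_derivative f (at x)) (at x)"
  by (simp flip: frechet_derivative_works)

lemma smooth_on_compose_affine:
  assumes "open T" "bounded_linear L" "\<And>x. x \<in> T \<Longrightarrow> L x + b \<in> S" "smooth_on S f"
  shows "smooth_on T (\<lambda>x. f (L x + b))"
proof -
  have "times_differentiable_on m T (\<lambda>x. f (L x + b))" if "times_differentiable_on m S f" for m
    using that
  proof (induction m arbitrary: f)
    case 0
    have "continuous_on T (\<lambda>x. L x + b)"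
      using assms(2) by (intro continuous_intros linear_continuous_on)
    then show ?case
      using 0 assms(3) by (auto intro: continuous_on_compose2)
  next
    case (Suc m)
    show ?case
    proof (rule times_differentiable_on_SucI[OF assms(1)])
      fix x assume "x \<in> T"
      then have "(f has_derivative frechet_derivative f (at (L x + b))) (at (L x + b))"
        using Suc.prems assms(3) by (intro times_differentiable_on_Suc_has_derivative)
      moreover have "((\<lambda>x. L x + b) has_derivative L) (at x)"
        using assms(2) by (auto intro!: derivative_eq_intros bounded_linear_imp_has_derivative)
      ultimately show "((\<lambda>x. f (L x + b)) has_derivative
          (\<lambda>v. frechet_derivative f (at (L x + b)) (L v))) (at x)"
        by (rule has_derivative_compose[rotated])
    qed (use Suc in auto)
  qed
  then show ?thesis using assms(4) by (simp add: smooth_on_def)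
qed

lemma smooth_on_bounded_linear:
  assumes "open S" "bounded_linear L" "smooth_on S f"
  shows "smooth_on S (\<lambda>x. L (f x))"
proof -
  have "times_differentiable_on m S (\<lambda>x. L (f x))" if "times_differentiable_on m S f" for m
    using that
  proof (induction m arbitrary: f)
    case 0
    then show ?case
      using assms(2) by (auto intro: bounded_linear.continuous_on)
  next
    case (Suc m)
    show ?case
    proof (rule times_differentiable_on_SucI[OF assms(1)])
      show "((\<lambda>x. L (f x)) has_derivative (\<lambda>v. L (frechet_derivative f (at x) v))) (at x)"
        if "x \<in> S" for x
        using assms(2) times_differentiable_on_Suc_has_derivative[OF Suc.prems that]
        by (rule bounded_linear.has_derivative)
    qed (use Suc in auto)
  qed
  then show ?thesis using assms(3) by (simp add: smooth_on_def)
qed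

lemma smooth_on_add:
  assumes "open S" "smooth_on S f" "smooth_on S g"
  shows "smooth_on S (\<lambda>x. f x + g x)"
proof -
  have "times_differentiable_on m S (\<lambda>x. f x + g x)"
    if "times_differentiable_on m S f" "times_differentiable_on m S g" for m
    using that
  proof (induction m arbitrary: f g)
    case 0
    then show ?case by (auto intro: continuous_intros)
  next
    case (Suc m)
    show ?case
    proof (rule times_differentiable_on_SucI[OF assms(1)])
      show "((\<lambda>x. f x + g x) has_derivative
          (\<lambda>v. frechet_derivative f (at x) v + frechet_derivative g (at x) v)) (at x)"
        if "x \<in> S" for x
        using Suc.prems[THEN times_differentiable_on_Suc_has_derivative, OF that]
        by (rule has_derivative_add)
    qed (use Suc in auto)
  qed
  then show ?thesis using assms(2,3) by (simp add: smooth_on_def)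
qed

lemma smooth_on_cmult:
  fixes f :: "'a::real_normed_vector \<Rightarrow> real"
  assumes "open S" "smooth_on S f"
  shows "smooth_on S (\<lambda>x. c * f x)"
  using smooth_on_bounded_linear[OF assms(1) bounded_linear_mult_right assms(2)] .

lemma smooth_on_diff:
  fixes f g :: "'a::real_normed_vector \<Rightarrow> real"
  assumes "open S" "smooth_on S f" "smooth_on S g"
  shows "smooth_on S (\<lambda>x. f x - g x)"
  using smooth_on_add[OF assms(1,2) smooth_on_cmult[OF assms(1,3), of "-1"]] by simp

lemma smooth_on_component:
  fixes f :: "'a::real_normed_vector \<Rightarrow> real^'n"
  assumes "open S" "smooth_on S f"
  shows "smooth_on S (\<lambda>x. f x $ i)"
  using smooth_on_bounded_linear[OF assms(1) bounded_linear_vec_nth assms(2)] .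

lemma has_derivative_power_inverse_coordinate:
  fixes x :: "real^'n"
  assumes "x $ i \<noteq> 0"
  shows "((\<lambda>x. a * inverse (x $ i) ^ k) has_derivative
    (\<lambda>v. - a * of_nat k * (v $ i) * inverse (x $ i) ^ Suc k)) (at x)"
proof -
  have "((\<lambda>t. a * inverse t ^ k) has_field_derivative - a * of_nat k * inverse (x $ i) ^ Suc k)
      (at (x $ i))"
    using DERIV_cmult[OF DERIV_power[OF DERIV_inverse[OF assms]], of a k]
    by (cases k) (simp_all add: algebra_simps)
  then have "((\<lambda>t. a * inverse t ^ k) has_derivative
      (\<lambda>t. (- a * of_nat k * inverse (x $ i) ^ Suc k) * t)) (at (x $ i))"
    by (simp only: has_field_derivative_def)
  moreover have "((\<lambda>x. x $ i) has_derivative (\<lambda>v. v $ i)) (at x)"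
    by (intro bounded_linear_imp_has_derivative bounded_linear_vec_nth)
  ultimately have "((\<lambda>x. a * inverse (x $ i) ^ k) has_derivative
      (\<lambda>v. (- a * of_nat k * inverse (x $ i) ^ Suc k) * v $ i)) (at x)"
    by (rule has_derivative_compose[rotated])
  then show ?thesis by (simp add: mult_ac)
qed

text \<open>The induction on the order needs all exponents and factors at once, since each directional
  derivative is again a multiple of a power of the inverse coordinate.\<close>

lemma smooth_on_power_inverse_coordinate:
  "smooth_on {x :: real^'n. x $ i > 0} (\<lambda>x. a * inverse (x $ i) ^ k)"
proof -
  have op: "open {x :: real^'n. x $ i > 0}"
    by (intro open_Collect_less continuous_intros)
  have "times_differentiable_on m {x :: real^'n. x $ i > 0} (\<lambda>x. a * inverse (x $ i) ^ k)" for m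
  proof (induction m arbitrary: a k)
    case 0
    then show ?case by (auto intro!: continuous_intros)
  next
    case (Suc m)
    show ?case
    proof (rule times_differentiable_on_SucI[OF op])
      fix x :: "real^'n" assume "x \<in> {x. x $ i > 0}"
      then show "((\<lambda>x. a * inverse (x $ i) ^ k) has_derivative
          (\<lambda>v. - a * of_nat k * (v $ i) * inverse (x $ i) ^ Suc k)) (at x)"
        by (intro has_derivative_power_inverse_coordinate) simp
    next
      show "times_differentiable_on m {x. x $ i > 0}
          (\<lambda>x. - a * of_nat k * (v $ i) * inverse (x $ i) ^ Suc k)" for v :: "real^'n"
        by (rule Suc)
    qed
  qed
  then show ?thesis by (simp add: smooth_on_def)
qed

section \<open>Partial derivatives\<close>

definition delta :: "'i \<Rightarrow> 'i \<Rightarrow> real" where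
  "delta i j = (if i = j then 1 else 0)"

lemma delta_simps [simp]:
  "delta i i = 1" "i \<noteq> j \<Longrightarrow> delta i j = 0"
  by (auto simp: delta_def)

lemma delta_commute: "delta i j = delta j i"
  by (simp add: delta_def)

lemma sum_delta [simp]:
  fixes a :: "'i::finite \<Rightarrow> real"
  shows "(\<Sum>i\<in>UNIV. a i * delta i j) = a j" "(\<Sum>i\<in>UNIV. a i * delta j i) = a j"
    "(\<Sum>i\<in>UNIV. delta i j * a i) = a j" "(\<Sum>i\<in>UNIV. delta j i * a i) = a j"
  by (simp_all add: delta_def if_distrib[of "\<lambda>t. t * _"] if_distrib[of "\<lambda>t. _ * t"] cong: if_cong)

lemma mat_nth_delta: "mat a $ i $ j = a * delta i j"
  by (simp add: mat_def delta_def)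

lemma partial_eqI: "(f has_derivative f') (at x) \<Longrightarrow> partial i f x = f' (axis i 1)"
  by (metis partial_def frechet_derivative_at)

lemma partial_cong:
  assumes "open S" "x \<in> S" "\<And>y. y \<in> S \<Longrightarrow> f y = g y" "f differentiable (at x)"
  shows "partial i f x = partial i g x"
  using partial_eqI[OF has_derivative_transform_within_open[OF
        assms(4)[unfolded frechet_derivative_works] assms(1-3)]]
  by (simp add: partial_def)

lemma partial_const: "partial i (\<lambda>y. c) x = 0"
  by (rule partial_eqI[where f' = "\<lambda>v. 0", THEN trans]) auto

lemma partial_coordinate: "partial i (\<lambda>y. y $ j) x = delta i j"
  by (simp add: partial_eqI[OF bounded_linear_imp_has_derivative[OF bounded_linear_vec_nth]]
      axis_def delta_def)

lemma partial_add:
  assumes "f differentiable (at x)" "g differentiable (at x)"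
  shows "partial i (\<lambda>y. f y + g y) x = partial i f x + partial i g x"
  using partial_eqI[OF has_derivative_add[OF assms[unfolded frechet_derivative_works]], of i]
  by (simp add: partial_def)

lemma partial_mult:
  assumes "f differentiable (at x)" "g differentiable (at x)"
  shows "partial i (\<lambda>y. f y * g y) x = f x * partial i g x + partial i f x * g x"
  using partial_eqI[OF has_derivative_mult[OF assms[unfolded frechet_derivative_works]], of i]
  by (simp add: partial_def)

lemma partial_cmult:
  assumes "f differentiable (at x)"
  shows "partial i (\<lambda>y. c * f y) x = c * partial i f x"
  using partial_mult[OF _ assms, of "\<lambda>y. c"] by (simp add: partial_const)

lemma partial_diff:
  assumes "f differentiable (at x)" "g differentiable (at x)"
  shows "partial i (\<lambda>y. f y - g y) x = partial i f x - partial i g x"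
  using partial_eqI[OF has_derivative_diff[OF assms[unfolded frechet_derivative_works]], of i]
  by (simp add: partial_def)

lemma differentiable_coordinate: "(\<lambda>y::real^'n. y $ j) differentiable (at x)"
  by (rule bounded_linear_imp_differentiable) (rule bounded_linear_vec_nth)

lemma partial_power_inverse_coordinate:
  fixes x :: "real^'n"
  assumes "x $ j \<noteq> 0"
  shows "partial i (\<lambda>y. a * inverse (y $ j) ^ k) x
    = - a * of_nat k * delta i j * inverse (x $ j) ^ Suc k"
  using partial_eqI[OF has_derivative_power_inverse_coordinate[OF assms]]
  by (simp add: axis_def delta_def)

lemma indep_of_var_on_imp_partial_eq_0:
  assumes "open S" "indep_of_var_on S i u" "u differentiable (at x)" "x \<in> S"
  shows "partial i u x = 0"
proof -
  let ?l = "\<lambda>t::real. x + t *\<^sub>R axis i 1"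
  let ?D = "frechet_derivative u (at x)"
  have "(u has_derivative ?D) (at (?l 0))"
    using assms(3) by (simp flip: frechet_derivative_works)
  moreover have "(?l has_derivative (\<lambda>t. t *\<^sub>R axis i 1)) (at 0)"
    by (auto intro!: derivative_eq_intros)
  ultimately have D: "((\<lambda>t. u (?l t)) has_derivative (\<lambda>t. ?D (t *\<^sub>R axis i 1))) (at 0)"
    by (rule has_derivative_compose[rotated])
  have "open (?l -` S)"
    using assms(1) by (intro open_vimage continuous_intros)
  moreover have "u (?l t) = u x" if "t \<in> ?l -` S" for t
    by (rule assms(2)[unfolded indep_of_var_on_def, rule_format])
      (use assms(4) that in \<open>simp_all add: axis_def\<close>)
  ultimately have "((\<lambda>t. u x) has_derivative (\<lambda>t. ?D (t *\<^sub>R axis i 1))) (at 0)"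
    using assms(4) by (intro has_derivative_transform_within_open[OF D, of "?l -` S"]) simp_all
  then have "(\<lambda>t. ?D (t *\<^sub>R axis i 1)) = (\<lambda>t. 0)"
    by (rule has_derivative_unique) simp
  then have "?D (1 *\<^sub>R axis i 1) = 0" by (rule fun_cong)
  then show ?thesis by (simp add: partial_def)
qed

text \<open>Convexity of \<open>S\<close> keeps the segment between two points that differ in coordinate \<open>i\<close>
  alone inside \<open>S\<close>, and the derivative along this segment is a multiple of \<open>partial i u\<close>.\<close>

lemma partial_eq_0_imp_indep_of_var_on:
  assumes "convex S" "\<And>x. x \<in> S \<Longrightarrow> u differentiable (at x)"
    and "\<And>x. x \<in> S \<Longrightarrow> partial i u x = 0"
  shows "indep_of_var_on S i u"
  unfolding indep_of_var_on_def
proof (intro ballI impI)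
  fix x y assume xy: "x \<in> S" "y \<in> S" and eq: "\<forall>j. j \<noteq> i \<longrightarrow> x $ j = y $ j"
  have d: "y - x = (y $ i - x $ i) *\<^sub>R axis i 1"
    using eq by (auto simp: vec_eq_iff axis_def)
  let ?l = "\<lambda>t::real. x + t *\<^sub>R (y - x)"
  have l: "?l t \<in> S" if "t \<in> {0..1}" for t
    using convexD_alt[OF assms(1) xy, of t] that by (simp add: algebra_simps)
  have "((\<lambda>t. u (?l t)) has_derivative (\<lambda>s. 0)) (at t within {0..1})" if "t \<in> {0..1}" for t
  proof -
    let ?D = "frechet_derivative u (at (?l t))"
    have D: "(u has_derivative ?D) (at (?l t))"
      using assms(2)[OF l[OF that]] by (simp flip: frechet_derivative_works)
    have "(?l has_derivative (\<lambda>s. s *\<^sub>R (y - x))) (at t within {0..1})"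
      by (auto intro!: derivative_eq_intros)
    then have "((\<lambda>t. u (?l t)) has_derivative (\<lambda>s. ?D (s *\<^sub>R (y - x)))) (at t within {0..1})"
      using D by (rule has_derivative_compose)
    moreover have "?D (s *\<^sub>R (y - x)) = 0" for s
      using assms(3)[OF l[OF that]] linear_scale[OF has_derivative_linear[OF D]]
      by (simp add: d partial_def)
    ultimately show ?thesis by simp
  qed
  then have "\<exists>c. \<forall>t\<in>{0..1}. u (?l t) = c"
    by (intro has_derivative_zero_constant) auto
  then obtain c where "\<And>t. t \<in> {0..1} \<Longrightarrow> u (?l t) = c" by blast
  from this[of 0] this[of 1] show "u x = u y" by simp
qed

section \<open>The upper half space\<close>

lemma open_upper_half_space [simp]: "open upper_half_space"
  unfolding upper_half_space_def by (intro open_Collect_less continuous_intros)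

lemma convex_upper_half_space: "convex upper_half_space"
  using convex_halfspace_gt[of 0 "axis None (1::real)"]
  by (simp add: upper_half_space_def inner_axis')

text \<open>The linear part of the section \<open>z \<mapsto> (z, 1)\<close> of \<open>first_coords\<close>. Restriction along this
  section turns a function on the half space that does not depend on the last variable into a
  function of the first ones; height one is chosen because the half space omits height zero.\<close>

definition horizontal :: "real^'m::finite \<Rightarrow> real^'m option" where
  "horizontal z = (\<chi> i. case i of None \<Rightarrow> 0 | Some k \<Rightarrow> z $ k)"

lemma horizontal_nth [simp]: "horizontal z $ None = 0" "horizontal z $ Some k = z $ k"
  by (simp_all add: horizontal_def)

lemma bounded_linear_horizontal: "bounded_linear horizontal"
  unfolding linear_conv_bounded_linear[symmetric]
  by (rule linearI; simp add: vec_eq_iff horizontal_def split: option.split)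

lemma bounded_linear_first_coords: "bounded_linear first_coords"
  unfolding linear_conv_bounded_linear[symmetric]
  by (rule linearI; simp add: vec_eq_iff first_coords_def)

lemma first_coords_axis [simp]:
  "first_coords (axis (Some k) a) = axis k a" "first_coords (axis None a) = 0"
  by (auto simp: vec_eq_iff first_coords_def axis_def)

lemma has_derivative_first_coords:
  assumes "u differentiable (at (first_coords x))"
  shows "((\<lambda>y. u (first_coords y)) has_derivative
      (\<lambda>v. frechet_derivative u (at (first_coords x)) (first_coords v))) (at x)"
  using bounded_linear_imp_has_derivative[OF bounded_linear_first_coords]
    assms[unfolded frechet_derivative_works]
  by (rule has_derivative_compose)

lemma partial_first_coords:
  assumes "u differentiable (at (first_coords x))"
  shows "partial (Some k) (\<lambda>y. u (first_coords y)) x = partial k u (first_coords x)"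
    and "partial None (\<lambda>y. u (first_coords y)) x = 0"
proof -
  show "partial (Some k) (\<lambda>y. u (first_coords y)) x = partial k u (first_coords x)"
    using partial_eqI[OF has_derivative_first_coords[OF assms], of "Some k"]
    by (simp add: partial_def)
  have "linear (frechet_derivative u (at (first_coords x)))"
    using assms by (simp add: linear_frechet_derivative)
  then show "partial None (\<lambda>y. u (first_coords y)) x = 0"
    using partial_eqI[OF has_derivative_first_coords[OF assms], of None]
    by (simp add: linear_0)
qed

section \<open>Curvature of hyperbolic space\<close>

lemma matrix_mult_mat: "mat a ** mat b = (mat (a * b) :: real^'n^'n)"
proof -
  have "(\<Sum>k\<in>UNIV. a * delta i k * (b * delta k j)) = a * b * delta i j" for i j :: 'n
    using sum_delta(1)[of "\<lambda>k. a * b * delta i k" j] by (simp add: mult_ac)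
  then show ?thesis
    by (simp add: vec_eq_iff matrix_matrix_mult_def mat_nth_delta)
qed

lemma matrix_inv_mat:
  assumes "a \<noteq> 0"
  shows "matrix_inv (mat a :: real^'n^'n) = mat (1 / a)"
  unfolding matrix_inv_def
proof (rule some_equality)
  show "mat a ** mat (1 / a) = (mat 1 :: real^'n^'n) \<and> mat (1 / a) ** mat a = (mat 1 :: real^'n^'n)"
    using assms by (simp add: matrix_mult_mat)
next
  fix B :: "real^'n^'n"
  assume "mat a ** B = mat 1 \<and> B ** mat a = mat 1"
  then have "B ** (mat a ** mat (1 / a)) = mat (1 / a)"
    by (simp add: matrix_mul_assoc)
  then show "B = mat (1 / a)"
    using assms by (simp add: matrix_mult_mat)
qed

text \<open>Up to the factor \<open>- 1 / x\<^sub>n\<close> these are the Christoffel symbols of the hyperbolic metric.\<close>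

definition hyperbolic_symbol :: "'m option \<Rightarrow> 'm option \<Rightarrow> 'm option \<Rightarrow> real" where
  "hyperbolic_symbol k i j =
     delta i None * delta j k + delta j None * delta i k - delta k None * delta i j"

lemma hyperbolic_metric_nth: "hyperbolic_metric x $ i $ j = delta i j * inverse (x $ None) ^ 2"
  by (simp add: hyperbolic_metric_def mat_nth_delta divide_inverse power_inverse)

lemma partial_hyperbolic_metric:
  assumes "x \<in> upper_half_space"
  shows "partial k (\<lambda>y. hyperbolic_metric y $ i $ j) x
    = - 2 * delta i j * delta k None * inverse (x $ None) ^ 3"
proof -
  have "x $ None \<noteq> 0" using assms by (simp add: upper_half_space_def)
  from partial_power_inverse_coordinate[OF this, of k "delta i j" 2]
  show ?thesis by (simp add: hyperbolic_metric_nth[abs_def] eval_nat_numeral)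
qed

lemma matrix_inv_hyperbolic_metric:
  assumes "x \<in> upper_half_space"
  shows "matrix_inv (hyperbolic_metric x) $ i $ j = (x $ None)\<^sup>2 * delta i j"
proof -
  have "x $ None \<noteq> 0" using assms by (simp add: upper_half_space_def)
  then show ?thesis by (simp add: hyperbolic_metric_def matrix_inv_mat mat_nth_delta)
qed

lemma christoffel_hyperbolic:
  assumes "x \<in> upper_half_space"
  shows "christoffel hyperbolic_metric k i j x = - hyperbolic_symbol k i j * inverse (x $ None) ^ 1"
proof -
  have y: "x $ None \<noteq> 0" using assms by (simp add: upper_half_space_def)
  have "christoffel hyperbolic_metric k i j x = (1/2) * ((x $ None)\<^sup>2 *
      (partial i (\<lambda>y. hyperbolic_metric y $ j $ k) x + partial j (\<lambda>y. hyperbolic_metric y $ i $ k) x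
         - partial k (\<lambda>y. hyperbolic_metric y $ i $ j) x))"
    unfolding christoffel_def matrix_inv_hyperbolic_metric[OF assms]
    by (simp only: mult.assoc sum_distrib_left[symmetric] sum_delta)
  also have "\<dots> = - hyperbolic_symbol k i j * inverse (x $ None) ^ 1"
    unfolding partial_hyperbolic_metric[OF assms] hyperbolic_symbol_def
    using y by (simp add: field_simps eval_nat_numeral)
  finally show ?thesis .
qed

lemma partial_christoffel_hyperbolic:
  assumes "x \<in> upper_half_space"
  shows "partial l (christoffel hyperbolic_metric k i j) x
    = delta l None * hyperbolic_symbol k i j * inverse (x $ None) ^ 2"
proof -
  have y: "x $ None \<noteq> 0" using assms by (simp add: upper_half_space_def)
  let ?u = "\<lambda>y. - hyperbolic_symbol k i j * inverse (y $ None) ^ 1"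
  have "?u differentiable (at x)"
    by (rule differentiableI[OF has_derivative_power_inverse_coordinate[OF y]])
  then have "partial l ?u x = partial l (christoffel hyperbolic_metric k i j) x"
    using assms by (intro partial_cong[OF open_upper_half_space]) (simp_all add: christoffel_hyperbolic)
  then show ?thesis
    using partial_power_inverse_coordinate[OF y, of l "- hyperbolic_symbol k i j" 1]
    by (simp add: eval_nat_numeral mult_ac)
qed

text \<open>Contracting against the three Kronecker deltas of the second factor; the last term
  comes from the fact that the symbol with \<open>None\<close> as a lower index is a Kronecker delta.\<close>

lemma sum_hyperbolic_symbol:
  fixes l i j k :: "'m::finite option"
  shows "(\<Sum>m\<in>UNIV. hyperbolic_symbol l i m * hyperbolic_symbol m j k)
    = delta j None * hyperbolic_symbol l i k + delta k None * hyperbolic_symbol l i j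
      - delta j k * delta i l"
proof -
  have "hyperbolic_symbol l i m * hyperbolic_symbol m j k =
      delta j None * (hyperbolic_symbol l i m * delta k m)
      + delta k None * (hyperbolic_symbol l i m * delta j m)
      - delta j k * (hyperbolic_symbol l i m * delta m None)" for m
    unfolding hyperbolic_symbol_def[of m j k] by (simp add: algebra_simps)
  then have "(\<Sum>m\<in>UNIV. hyperbolic_symbol l i m * hyperbolic_symbol m j k)
    = delta j None * hyperbolic_symbol l i k + delta k None * hyperbolic_symbol l i j
      - delta j k * hyperbolic_symbol l i None"
    by (simp only: sum.distrib sum_subtractf sum_distrib_left[symmetric] sum_delta)
  moreover have "hyperbolic_symbol l i None = delta i l"
    by (simp add: hyperbolic_symbol_def delta_commute)
  ultimately show ?thesis by simp
qed

text \<open>Constant sectional curvature \<open>- 1\<close>: the products of Christoffel symbols cancel their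
  derivatives and leave only the two terms that come from the last term of
  \<open>sum_hyperbolic_symbol\<close>.\<close>

lemma riemann_hyperbolic:
  assumes "x \<in> upper_half_space"
  shows "riemann hyperbolic_metric l k i j x
    = (delta i k * delta j l - delta j k * delta i l) * inverse (x $ None) ^ 2"
proof -
  let ?e = "hyperbolic_symbol" and ?r = "inverse (x $ None)"
  have sym: "?e l j i = ?e l i j"
    by (simp add: hyperbolic_symbol_def delta_commute)
  have "riemann hyperbolic_metric l k i j x =
      (delta i None * ?e l j k - delta j None * ?e l i k
       + (\<Sum>m\<in>UNIV. ?e l i m * ?e m j k) - (\<Sum>m\<in>UNIV. ?e l j m * ?e m i k)) * ?r ^ 2"
    unfolding riemann_def partial_christoffel_hyperbolic[OF assms] christoffel_hyperbolic[OF assms]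
    by (simp add: algebra_simps sum_subtractf sum_distrib_left sum_distrib_right power2_eq_square)
  then show ?thesis
    unfolding sum_hyperbolic_symbol by (simp add: sym algebra_simps)
qed

lemma ricci_hyperbolic:
  fixes x :: "real^'m::finite option"
  assumes "x \<in> upper_half_space"
  shows "ricci hyperbolic_metric x $ j $ k
    = - real CARD('m) * delta j k * inverse (x $ None) ^ 2"
proof -
  have "ricci hyperbolic_metric x $ j $ k
      = (\<Sum>i\<in>UNIV. delta i k * delta j i - delta j k) * inverse (x $ None) ^ 2"
    unfolding ricci_def by (simp add: riemann_hyperbolic[OF assms] sum_distrib_right)
  also have "(\<Sum>i\<in>UNIV. delta i k * delta j i - delta j k) = - real CARD('m) * delta j k"
    by (simp only: sum_subtractf sum_delta) (simp add: algebra_simps card_option)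
  finally show ?thesis .
qed

lemma scalar_curvature_hyperbolic:
  fixes x :: "real^'m::finite option"
  assumes "x \<in> upper_half_space"
  shows "scalar_curvature hyperbolic_metric x = - real CARD('m option) * real CARD('m)"
proof -
  have y: "x $ None \<noteq> 0" using assms by (simp add: upper_half_space_def)
  have "scalar_curvature hyperbolic_metric x =
      (\<Sum>i\<in>(UNIV :: 'm option set). \<Sum>j\<in>UNIV. - real CARD('m) * (delta i j * delta i j))"
    unfolding scalar_curvature_def matrix_inv_hyperbolic_metric[OF assms] ricci_hyperbolic[OF assms]
    using y by (intro sum.cong refl) (simp add: field_simps)
  also have "\<dots> = - real CARD('m option) * real CARD('m)"
    by (simp only: sum_distrib_left[symmetric] sum_delta) (simp add: algebra_simps)
  finally show ?thesis .
qed

lemma riemannian_metric_on_hyperbolic_metric: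
  "riemannian_metric_on upper_half_space (hyperbolic_metric :: real^'m::finite option \<Rightarrow> _)"
  unfolding riemannian_metric_on_def
proof (intro conjI ballI allI impI)
  have "bounded_linear (\<lambda>a. a *\<^sub>R (mat 1 :: real^'m option^'m option))"
    by (rule bounded_linear_scaleR_left)
  from smooth_on_bounded_linear[OF open_upper_half_space this
      smooth_on_power_inverse_coordinate[of None 1 2, folded upper_half_space_def]]
  show "smooth_on upper_half_space (hyperbolic_metric :: real^'m option \<Rightarrow> _)"
    by (rule back_subst[of "smooth_on upper_half_space"])
      (auto simp: fun_eq_iff vec_eq_iff hyperbolic_metric_nth mat_nth_delta)
next
  fix x v :: "real^'m option" assume x: "x \<in> upper_half_space"
  show "transpose (hyperbolic_metric x) = hyperbolic_metric x"
    by (simp add: hyperbolic_metric_def transpose_mat)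
  assume "v \<noteq> 0"
  have "hyperbolic_metric x *v v = (1 / (x $ None)\<^sup>2) *\<^sub>R v"
    by (simp only: vec_eq_iff matrix_vector_mult_def vec_lambda_beta hyperbolic_metric_def
        mat_nth_delta mult.assoc sum_distrib_left[symmetric] sum_delta vector_scaleR_component
        real_scaleR_def) simp
  then show "v \<bullet> (hyperbolic_metric x *v v) > 0"
    using x \<open>v \<noteq> 0\<close> by (simp add: upper_half_space_def)
qed

section \<open>The soliton equation in coordinates\<close>

text \<open>The product rule for \<open>\<delta> / x\<^sub>n\<^sup>2\<close>: the last term is the derivative of the conformal factor
  along \<open>X\<close>.\<close>

lemma lie_derivative_hyperbolic:
  assumes "x \<in> upper_half_space"
  shows "lie_derivative X hyperbolic_metric x $ i $ j =
    (partial i (\<lambda>y. X y $ j) x + partial j (\<lambda>y. X y $ i) x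
       - 2 * (X x $ None / x $ None) * delta i j) * inverse (x $ None) ^ 2"
proof -
  let ?r = "inverse (x $ None)"
  have "lie_derivative X hyperbolic_metric x $ i $ j =
      (\<Sum>k\<in>UNIV. (- 2 * delta i j * ?r ^ 3) * (X x $ k * delta k None)
        + ?r ^ 2 * (partial i (\<lambda>y. X y $ k) x * delta k j)
        + ?r ^ 2 * (partial j (\<lambda>y. X y $ k) x * delta i k))"
    unfolding lie_derivative_def vec_lambda_beta partial_hyperbolic_metric[OF assms]
    unfolding hyperbolic_metric_nth
    by (simp add: algebra_simps)
  also have "\<dots> = (- 2 * delta i j * ?r ^ 3) * X x $ None
      + ?r ^ 2 * partial i (\<lambda>y. X y $ j) x + ?r ^ 2 * partial j (\<lambda>y. X y $ i) x"
    by (simp only: sum.distrib sum_distrib_left[symmetric] sum_delta)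
  finally show ?thesis
    by (simp add: algebra_simps divide_inverse eval_nat_numeral)
qed

text \<open>This says that \<open>X\<close> is a conformal Killing field, with factor \<open>2 \<cdot> \<phi>\<close>, of the flat metric
  \<open>\<delta>\<close>, to which the hyperbolic metric is conformal.\<close>

definition flat_conformal_killing_on ::
    "(real^'n::finite) set \<Rightarrow> (real^'n \<Rightarrow> real^'n) \<Rightarrow> (real^'n \<Rightarrow> real) \<Rightarrow> bool" where
  "flat_conformal_killing_on S X \<phi> \<longleftrightarrow>
     (\<forall>x\<in>S. \<forall>i j. partial i (\<lambda>y. X y $ j) x + partial j (\<lambda>y. X y $ i) x = 2 * \<phi> x * delta i j)"

text \<open>The constant \<open>c\<close> collects \<open>\<lambda>\<close>, the term \<open>- \<rho> n (n - 1)\<close> from the scalar curvature and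
  \<open>n - 1\<close> from the Ricci tensor, moved to the right-hand side. The common factor
  \<open>G / (2 x\<^sub>n\<^sup>2)\<close> that remains does not vanish and can be cancelled.\<close>

lemma soliton_iff_flat_conformal_killing:
  fixes X :: "real^'m::finite option \<Rightarrow> real^'m option"
  assumes n: "n = real CARD('m option)" and c: "c = lam + (n - 1) * (1 - n * rho)"
    and X: "smooth_on upper_half_space X"
    and G: "smooth_on upper_half_space G" "\<forall>x\<in>upper_half_space. G x \<noteq> 0"
  shows "G_ricci_bourguignon_soliton upper_half_space hyperbolic_metric X lam rho G \<longleftrightarrow>
    flat_conformal_killing_on upper_half_space X (\<lambda>x. X x $ None / x $ None + c / G x)"
proof -
  have m: "real CARD('m) = n - 1" by (simp add: n card_option)
  have "ricci hyperbolic_metric x + (G x / 2) *\<^sub>R lie_derivative X hyperbolic_metric x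
      = (lam + rho * scalar_curvature hyperbolic_metric x) *\<^sub>R hyperbolic_metric x \<longleftrightarrow>
    (\<forall>i j. partial i (\<lambda>y. X y $ j) x + partial j (\<lambda>y. X y $ i) x
      = 2 * (X x $ None / x $ None + c / G x) * delta i j)"
    (is "?l \<longleftrightarrow> ?r") if x: "x \<in> upper_half_space" for x
  proof -
    have nz: "x $ None \<noteq> 0" "G x \<noteq> 0" using x G(2) by (auto simp: upper_half_space_def)
    have cancel: "- (n - 1) * d * r ^ 2 + (g / 2) * ((p - 2 * a * d) * r ^ 2)
          = (lam + rho * (- n * (n - 1))) * (d * r ^ 2) \<longleftrightarrow> p = 2 * (a + c / g) * d"
      if "r \<noteq> 0" "g \<noteq> 0" for d r g p a
    proof -
      have "- (n - 1) * d * r ^ 2 + (g / 2) * ((p - 2 * a * d) * r ^ 2)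
          - (lam + rho * (- n * (n - 1))) * (d * r ^ 2)
          = (g / 2 * r ^ 2) * (p - 2 * (a + c / g) * d)"
        using that unfolding c by (simp add: field_simps)
      then show ?thesis using that by (smt (verit) divide_eq_0_iff mult_eq_0_iff power_not_zero)
    qed
    have "?l \<longleftrightarrow> (\<forall>i j. - (n - 1) * delta i j * inverse (x $ None) ^ 2
       + (G x / 2) * ((partial i (\<lambda>y. X y $ j) x + partial j (\<lambda>y. X y $ i) x
           - 2 * (X x $ None / x $ None) * delta i j) * inverse (x $ None) ^ 2)
       = (lam + rho * (- n * (n - 1))) * (delta i j * inverse (x $ None) ^ 2))"
      unfolding vec_eq_iff vector_add_component vector_scaleR_component real_scaleR_def
        ricci_hyperbolic[OF x] lie_derivative_hyperbolic[OF x] scalar_curvature_hyperbolic[OF x]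
        hyperbolic_metric_nth m n[symmetric] by (rule refl)
    also have "\<dots> \<longleftrightarrow> ?r" by (simp only: cancel[OF nonzero_imp_inverse_nonzero[OF nz(1)] nz(2)])
    finally show ?thesis .
  qed
  then show ?thesis
    unfolding G_ricci_bourguignon_soliton_def flat_conformal_killing_on_def
    using X G by (simp add: riemannian_metric_on_hyperbolic_metric)
qed

section \<open>Integration of the soliton equation\<close>


lemma sum_scaleR_axis_nth [simp]:
  fixes a :: "'m::finite \<Rightarrow> real"
  shows "(\<Sum>k\<in>UNIV. a k *\<^sub>R axis (Some k) 1 :: real^'m option) $ Some j = a j"
    and "(\<Sum>k\<in>UNIV. a k *\<^sub>R axis (Some k) 1 :: real^'m option) $ None = 0"
  by (simp_all add: axis_def if_distrib[of "\<lambda>t. _ * t"] cong: if_cong)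

lemma antiderivative_on_differentiable:
  "antiderivative_on S i u U \<Longrightarrow> x \<in> S \<Longrightarrow> U differentiable (at x)"
  by (auto simp: antiderivative_on_def intro: smooth_on_differentiable)

lemma antiderivative_on_partial: "antiderivative_on S i u U \<Longrightarrow> x \<in> S \<Longrightarrow> partial i U x = u x"
  by (simp add: antiderivative_on_def)

lemma differentiable_first_coords:
  "u differentiable (at (first_coords x)) \<Longrightarrow> (\<lambda>y. u (first_coords y)) differentiable (at x)"
  using has_derivative_first_coords by (auto simp: differentiable_def)

text \<open>For a field of the integrated form the diagonal equations hold automatically. The equation
  with indices \<open>k\<close> and \<open>n\<close> is the first constraint, and those with indices \<open>k \<noteq> j\<close> are the second
  one.\<close>

lemma flat_conformal_killing_iff_constraints:
  fixes X :: "real^'m::finite option \<Rightarrow> real^'m option"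
    and E :: "'m \<Rightarrow> real^'m \<Rightarrow> real"
  assumes P: "antiderivative_on upper_half_space None (\<lambda>x. 1 / (x $ None * G x)) P"
    and Q: "\<And>k. antiderivative_on upper_half_space (Some k) P (Q k)"
    and R: "\<And>k. antiderivative_on upper_half_space (Some k) (\<lambda>x. 1 / G x) (R k)"
    and f: "smooth_on UNIV f" and E: "\<And>k. antiderivative_on UNIV k f (E k)"
    and h: "\<And>k. smooth_on upper_half_space (h k)"
      "\<And>k. indep_of_var_on upper_half_space (Some k) (h k)"
    and X_Some: "\<forall>x\<in>upper_half_space. \<forall>k.
      X x $ Some k = E k (first_coords x) + c * Q k x + c * R k x + h k x"
    and X_None: "\<forall>x\<in>upper_half_space.
      X x $ None = x $ None * f (first_coords x) + c * (x $ None * P x)"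
  shows "flat_conformal_killing_on upper_half_space X (\<lambda>x. X x $ None / x $ None + c / G x) \<longleftrightarrow>
    (\<forall>x\<in>upper_half_space. \<forall>k. partial None (h k) x =
        - (x $ None) * partial k f (first_coords x)
        - c * (partial (Some k) (\<lambda>y. y $ None * P y) x + partial None (\<lambda>y. Q k y + R k y) x)) \<and>
    (\<forall>x\<in>upper_half_space. \<forall>k j. k \<noteq> j \<longrightarrow>
        partial j (E k) (first_coords x) + partial k (E j) (first_coords x)
          + partial (Some j) (h k) x + partial (Some k) (h j) x =
        - c * partial (Some j) (\<lambda>y. R k y + Q k y) x - c * partial (Some k) (\<lambda>y. R j y + Q j y) x)"
proof -
  define eq where "eq x i j \<longleftrightarrow> partial i (\<lambda>y. X y $ j) x + partial j (\<lambda>y. X y $ i) x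
      = 2 * (X x $ None / x $ None + c / G x) * delta i j" for x i j
  have eqs: "(\<forall>i j. eq x i j) \<longleftrightarrow>
     (\<forall>k. partial None (h k) x =
        - (x $ None) * partial k f (first_coords x)
        - c * (partial (Some k) (\<lambda>y. y $ None * P y) x + partial None (\<lambda>y. Q k y + R k y) x)) \<and>
     (\<forall>k j. k \<noteq> j \<longrightarrow>
        partial j (E k) (first_coords x) + partial k (E j) (first_coords x)
          + partial (Some j) (h k) x + partial (Some k) (h j) x =
        - c * partial (Some j) (\<lambda>y. R k y + Q k y) x - c * partial (Some k) (\<lambda>y. R j y + Q j y) x)"
    (is "_ \<longleftrightarrow> (\<forall>k. ?C1 k) \<and> (\<forall>k j. k \<noteq> j \<longrightarrow> ?C2 k j)")
    if x: "x \<in> upper_half_space" for x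
  proof -
    have y: "x $ None \<noteq> 0" using x by (simp add: upper_half_space_def)
    have df: "f differentiable (at (first_coords x))" "\<And>k. E k differentiable (at (first_coords x))"
      using smooth_on_differentiable[OF f] antiderivative_on_differentiable[OF E] by auto
    note d = antiderivative_on_differentiable[OF P x] antiderivative_on_differentiable[OF Q x]
      antiderivative_on_differentiable[OF R x] smooth_on_differentiable[OF h(1) x]
      differentiable_coordinate differentiable_first_coords[OF df(1)]
      differentiable_first_coords[OF df(2)]
    have QR: "partial i (\<lambda>y. Q k y + R k y) x = partial i (Q k) x + partial i (R k) x"
      "partial i (\<lambda>y. R k y + Q k y) x = partial i (R k) x + partial i (Q k) x" for i k
      by (simp_all add: partial_add d)
    have yP: "partial i (\<lambda>y. y $ None * P y) x = x $ None * partial i P x + delta i None * P x" for i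
      by (simp add: partial_mult partial_coordinate d)
    have XS: "partial i (\<lambda>y. X y $ Some k) x = partial i (\<lambda>y. E k (first_coords y)) x
        + c * partial i (Q k) x + c * partial i (R k) x + partial i (h k) x" for i k
    proof -
      have "partial i (\<lambda>y. X y $ Some k) x
          = partial i (\<lambda>y. E k (first_coords y) + c * Q k y + c * R k y + h k y) x"
        using X_Some x
        by (intro partial_cong[OF open_upper_half_space, symmetric]) (auto intro!: derivative_intros d)
      then show ?thesis by (simp add: partial_add partial_cmult d)
    qed
    have XN: "partial i (\<lambda>y. X y $ None) x = x $ None * partial i (\<lambda>y. f (first_coords y)) x
        + delta i None * f (first_coords x) + c * partial i (\<lambda>y. y $ None * P y) x" for i
    proof -
      have "partial i (\<lambda>y. X y $ None) x
          = partial i (\<lambda>y. y $ None * f (first_coords y) + c * (y $ None * P y)) x"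
        using X_None x
        by (intro partial_cong[OF open_upper_half_space, symmetric]) (auto intro!: derivative_intros d)
      then show ?thesis by (simp add: partial_add partial_mult partial_const partial_coordinate d)
    qed
    note parts = XS XN yP QR partial_first_coords[OF df(1)] partial_first_coords[OF df(2)]
      antiderivative_on_partial[OF P x] antiderivative_on_partial[OF Q x]
      antiderivative_on_partial[OF R x] antiderivative_on_partial[OF E UNIV_I]
      indep_of_var_on_imp_partial_eq_0[OF open_upper_half_space h(2)
        smooth_on_differentiable[OF h(1) x] x] bspec[OF X_None x]
    have kn: "eq x (Some k) None \<longleftrightarrow> eq x None (Some k)" for k
      unfolding eq_def by (simp add: add.commute delta_commute)
    have nn: "eq x None None"
      unfolding eq_def parts using y by (simp add: field_simps)
    have kk: "eq x (Some k) (Some k)" for k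
      unfolding eq_def parts using y by (simp add: field_simps)
    have nk: "eq x None (Some k) \<longleftrightarrow> ?C1 k" for k
      unfolding eq_def parts by (auto simp: algebra_simps)
    have kj: "eq x (Some k) (Some j) \<longleftrightarrow> ?C2 k j" if "k \<noteq> j" for k j
      unfolding eq_def parts using that by (auto simp: algebra_simps)
    have "(\<forall>i j. eq x i j) \<longleftrightarrow>
      (\<forall>k. eq x None (Some k)) \<and> (\<forall>k j. k \<noteq> j \<longrightarrow> eq x (Some k) (Some j))" (is "_ \<longleftrightarrow> ?rhs")
    proof
      assume rhs: ?rhs
      have "eq x (Some k) (Some j)" for k j
        using rhs kk by (cases "k = j") simp_all
      then show "\<forall>i j. eq x i j"
        using rhs nn kn by (simp add: split_option_all)
    qed simp
    also have "\<dots> \<longleftrightarrow> (\<forall>k. ?C1 k) \<and> (\<forall>k j. k \<noteq> j \<longrightarrow> ?C2 k j)"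
      unfolding nk by (intro arg_cong2[where f = "(\<and>)"] arg_cong[where f = All] ext imp_cong refl kj)
    finally show ?thesis .
  qed
  show ?thesis
    unfolding flat_conformal_killing_on_def eq_def[symmetric] ball_conj_distrib[symmetric]
    by (rule ball_cong[OF refl eqs])
qed

text \<open>Integration of the diagonal equations. The equation for the last variable says that
  \<open>X\<^sub>n / x\<^sub>n - c P\<close> does not depend on \<open>x\<^sub>n\<close>, so that this function is its restriction \<open>f\<close> to
  height one; the remaining ones then say that \<open>h\<^sub>k\<close>, defined as what is left of \<open>X\<^sub>k\<close>, does not
  depend on \<open>x\<^sub>k\<close>.\<close>

lemma flat_conformal_killing_imp_primitives:
  fixes X :: "real^'m::finite option \<Rightarrow> real^'m option"
    and F :: "(real^'m \<Rightarrow> real) \<Rightarrow> 'm \<Rightarrow> real^'m \<Rightarrow> real"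
  assumes X: "smooth_on upper_half_space X"
    and P: "antiderivative_on upper_half_space None (\<lambda>x. 1 / (x $ None * G x)) P"
    and Q: "\<And>k. antiderivative_on upper_half_space (Some k) P (Q k)"
    and R: "\<And>k. antiderivative_on upper_half_space (Some k) (\<lambda>x. 1 / G x) (R k)"
    and F: "\<And>f k. smooth_on UNIV f \<Longrightarrow> antiderivative_on UNIV k f (F f k)"
    and K: "flat_conformal_killing_on upper_half_space X (\<lambda>x. X x $ None / x $ None + c / G x)"
  obtains f h where "smooth_on UNIV f" "\<And>k. smooth_on upper_half_space (h k)"
    "\<And>k. indep_of_var_on upper_half_space (Some k) (h k)"
    "\<forall>x\<in>upper_half_space. \<forall>k.
      X x $ Some k = F f k (first_coords x) + c * Q k x + c * R k x + h k x"
    "\<forall>x\<in>upper_half_space.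
      X x $ None = x $ None * f (first_coords x) + c * (x $ None * P x)"
proof -
  have diag: "partial i (\<lambda>y. X y $ i) x = X x $ None / x $ None + c / G x"
    if "x \<in> upper_half_space" for x i
  proof -
    have "partial i (\<lambda>y. X y $ i) x + partial i (\<lambda>y. X y $ i) x
        = 2 * (X x $ None / x $ None + c / G x) * delta i i"
      using K that unfolding flat_conformal_killing_on_def by blast
    then show ?thesis by simp
  qed
  have sX: "smooth_on upper_half_space (\<lambda>x. X x $ i)" for i
    using X by (intro smooth_on_component) simp_all
  have sP: "smooth_on upper_half_space P" "\<And>k. smooth_on upper_half_space (Q k)"
    "\<And>k. smooth_on upper_half_space (R k)"
    using P Q R by (simp_all add: antiderivative_on_def)
  have wall: "horizontal z + axis None 1 \<in> upper_half_space" for z :: "real^'m"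
    by (simp add: upper_half_space_def)
  define f where
    "f z = X (horizontal z + axis None 1) $ None - c * P (horizontal z + axis None 1)" for z
  have sf: "smooth_on UNIV f"
    unfolding f_def using sX sP wall
    by (intro smooth_on_diff smooth_on_cmult open_UNIV
        smooth_on_compose_affine[OF open_UNIV bounded_linear_horizontal, of _ upper_half_space])
  note sE = F[OF sf, unfolded antiderivative_on_def, THEN conjunct1]
  have sE': "smooth_on upper_half_space (\<lambda>x. F f k (first_coords x))" for k
    using smooth_on_compose_affine[OF open_upper_half_space bounded_linear_first_coords _ sE,
        of 0 k] by simp
  \<comment> \<open>The quotient \<open>X\<^sub>n / x\<^sub>n - c P\<close>, with the power of the inverse in the form that the
    differentiation rule for powers expects.\<close>
  let ?u = "\<lambda>x. X x $ None * inverse (x $ None) ^ 1 - c * P x"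
  have dinv: "(\<lambda>y. inverse (y $ None) ^ 1) differentiable (at x)"
    if "x \<in> upper_half_space" for x :: "real^'m option"
    using that has_derivative_power_inverse_coordinate[of x None 1 1]
    by (auto simp: upper_half_space_def differentiable_def)
  have du: "?u differentiable (at x)" "partial None ?u x = 0" if x: "x \<in> upper_half_space" for x
  proof -
    have y: "x $ None \<noteq> 0" using x by (simp add: upper_half_space_def)
    note d = smooth_on_differentiable[OF sX x] smooth_on_differentiable[OF sP(1) x] dinv[OF x]
    show "?u differentiable (at x)"
      by (intro derivative_intros d)
    have "partial None (\<lambda>y. inverse (y $ None) ^ 1) x = - (inverse (x $ None) ^ 2)"
      using partial_power_inverse_coordinate[OF y, of None 1 1] by (simp add: eval_nat_numeral)
    moreover have "partial None ?u x = X x $ None * partial None (\<lambda>y. inverse (y $ None) ^ 1) x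
        + partial None (\<lambda>y. X y $ None) x * inverse (x $ None) ^ 1 - c * partial None P x"
      by (subst partial_diff partial_mult partial_cmult; (intro derivative_intros d)?)+ (rule refl)
    ultimately show "partial None ?u x = 0"
      using y by (simp add: diag[OF x] antiderivative_on_partial[OF P x]
          divide_inverse power2_eq_square algebra_simps)
  qed
  have u_indep: "indep_of_var_on upper_half_space None ?u"
    using du by (intro partial_eq_0_imp_indep_of_var_on convex_upper_half_space)
  have u: "?u x = f (first_coords x)" if x: "x \<in> upper_half_space" for x
  proof -
    let ?z = "horizontal (first_coords x) + axis None 1"
    have "x $ j = ?z $ j" if "j \<noteq> None" for j
      using that by (cases j) (auto simp: first_coords_def axis_def)
    then have "?u x = ?u ?z"
      using u_indep x wall unfolding indep_of_var_on_def by blast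
    then show ?thesis by (simp add: f_def)
  qed
  have XN: "X x $ None = x $ None * f (first_coords x) + c * (x $ None * P x)"
    if x: "x \<in> upper_half_space" for x
  proof -
    have "x $ None \<noteq> 0" using x by (simp add: upper_half_space_def)
    then show ?thesis using u[OF x] by (simp add: field_simps)
  qed
  \<comment> \<open>The remainder absorbs the integration constants in the chosen antiderivatives.\<close>
  define h where "h k x = X x $ Some k - F f k (first_coords x) - c * Q k x - c * R k x" for k x
  have sh: "smooth_on upper_half_space (h k)" for k
    unfolding h_def[abs_def] by (intro smooth_on_diff smooth_on_cmult sX sP sE' open_upper_half_space)
  have "indep_of_var_on upper_half_space (Some k) (h k)" for k
  proof (rule partial_eq_0_imp_indep_of_var_on[OF convex_upper_half_space])
    fix x :: "real^'m option" assume x: "x \<in> upper_half_space"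
    show "h k differentiable (at x)" using sh x by (rule smooth_on_differentiable)
    note d = smooth_on_differentiable[OF sX x] smooth_on_differentiable[OF sP(2) x]
      smooth_on_differentiable[OF sP(3) x] smooth_on_differentiable[OF sE' x]
    have "partial (Some k) (h k) x = partial (Some k) (\<lambda>y. X y $ Some k) x
        - partial (Some k) (\<lambda>y. F f k (first_coords y)) x
        - c * partial (Some k) (Q k) x - c * partial (Some k) (R k) x"
      unfolding h_def[abs_def] by (simp add: partial_diff partial_cmult d)
    also have "\<dots> = (X x $ None / x $ None + c / G x) - f (first_coords x) - c * P x - c / G x"
      using smooth_on_differentiable[OF sE UNIV_I]
      by (simp add: diag[OF x] partial_first_coords antiderivative_on_partial[OF Q x]
          antiderivative_on_partial[OF R x] antiderivative_on_partial[OF F[OF sf] UNIV_I])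
    also have "\<dots> = 0" using u[OF x] by (simp add: divide_inverse)
    finally show "partial (Some k) (h k) x = 0" .
  qed
  then show thesis
    using that[of f h] sf sh XN by (simp add: h_def)
qed

theorem theorem3p8:
  fixes X :: "real^'m::finite option \<Rightarrow> real^'m option"
    and G P :: "real^'m option \<Rightarrow> real"
    and Q R :: "'m \<Rightarrow> real^'m option \<Rightarrow> real"
    and F :: "(real^'m \<Rightarrow> real) \<Rightarrow> 'm \<Rightarrow> real^'m \<Rightarrow> real"
    and lam rho n :: real
  assumes n: "n = real CARD('m option)"
    and X: "smooth_on upper_half_space X"
    and G: "smooth_on upper_half_space G" "\<forall>x\<in>upper_half_space. G x \<noteq> 0"
    and P: "antiderivative_on upper_half_space None (\<lambda>x. 1 / (x $ None * G x)) P"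
    and Q: "\<forall>k. antiderivative_on upper_half_space (Some k) P (Q k)"
    and R: "\<forall>k. antiderivative_on upper_half_space (Some k) (\<lambda>x. 1 / G x) (R k)"
    and F: "\<forall>f k. smooth_on UNIV f \<longrightarrow> antiderivative_on UNIV k f (F f k)"
  shows "G_ricci_bourguignon_soliton upper_half_space hyperbolic_metric X lam rho G \<longleftrightarrow>
    (\<exists>(f :: real^'m \<Rightarrow> real) (h :: 'm \<Rightarrow> real^'m option \<Rightarrow> real).
       smooth_on UNIV f \<and>
       (\<forall>k. smooth_on upper_half_space (h k) \<and> indep_of_var_on upper_half_space (Some k) (h k)) \<and>
       (\<forall>x\<in>upper_half_space.
          X x = (\<Sum>k\<in>UNIV. F f k (first_coords x) *\<^sub>R axis (Some k) 1)
              + (lam + (n - 1) * (1 - n * rho)) *\<^sub>R (\<Sum>k\<in>UNIV. Q k x *\<^sub>R axis (Some k) 1)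
              + (lam + (n - 1) * (1 - n * rho)) *\<^sub>R (\<Sum>k\<in>UNIV. R k x *\<^sub>R axis (Some k) 1)
              + (\<Sum>k\<in>UNIV. h k x *\<^sub>R axis (Some k) 1)
              + (f (first_coords x) * x $ None
                 + (lam + (n - 1) * (1 - n * rho)) * (x $ None * P x)) *\<^sub>R axis None 1) \<and>
       (\<forall>x\<in>upper_half_space. \<forall>k.
          partial None (h k) x =
            - (x $ None) * partial k f (first_coords x)
            + (- lam + (n - 1) * (n * rho - 1)) *
                (partial (Some k) (\<lambda>y. y $ None * P y) x
                 + partial None (\<lambda>y. Q k y + R k y) x)) \<and>
       (\<forall>x\<in>upper_half_space. \<forall>k j. k \<noteq> j \<longrightarrow>
          partial j (F f k) (first_coords x) + partial k (F f j) (first_coords x)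
            + partial (Some j) (h k) x + partial (Some k) (h j) x =
          (- lam + (n - 1) * (n * rho - 1)) * partial (Some j) (\<lambda>y. R k y + Q k y) x
            + (- lam + (n - 1) * (n * rho - 1)) * partial (Some k) (\<lambda>y. R j y + Q j y) x))"
proof -
  define c where "c = lam + (n - 1) * (1 - n * rho)"
  have c': "- lam + (n - 1) * (n * rho - 1) = - c"
    by (simp add: c_def algebra_simps)
  have components: "X x = (\<Sum>k\<in>UNIV. F f k (first_coords x) *\<^sub>R axis (Some k) 1)
        + c *\<^sub>R (\<Sum>k\<in>UNIV. Q k x *\<^sub>R axis (Some k) 1)
        + c *\<^sub>R (\<Sum>k\<in>UNIV. R k x *\<^sub>R axis (Some k) 1)
        + (\<Sum>k\<in>UNIV. h k x *\<^sub>R axis (Some k) 1)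
        + (f (first_coords x) * x $ None + c * (x $ None * P x)) *\<^sub>R axis None 1 \<longleftrightarrow>
      (\<forall>k. X x $ Some k = F f k (first_coords x) + c * Q k x + c * R k x + h k x) \<and>
      X x $ None = x $ None * f (first_coords x) + c * (x $ None * P x)"
    for f :: "real^'m \<Rightarrow> real" and h :: "'m \<Rightarrow> real^'m option \<Rightarrow> real" and x
    by (simp only: vec_eq_iff split_option_all vector_add_component vector_scaleR_component
        sum_scaleR_axis_nth) (auto simp: axis_def mult.commute)
  show ?thesis
    (is "_ \<longleftrightarrow> ?rhs")
    unfolding soliton_iff_flat_conformal_killing[OF n c_def X G]
  proof
    assume K: "flat_conformal_killing_on upper_half_space X (\<lambda>x. X x $ None / x $ None + c / G x)"
    obtain f h where *: "smooth_on UNIV f" "\<And>k. smooth_on upper_half_space (h k)"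
      "\<And>k. indep_of_var_on upper_half_space (Some k) (h k)"
      "\<forall>x\<in>upper_half_space. \<forall>k.
        X x $ Some k = F f k (first_coords x) + c * Q k x + c * R k x + h k x"
      "\<forall>x\<in>upper_half_space.
        X x $ None = x $ None * f (first_coords x) + c * (x $ None * P x)"
      using flat_conformal_killing_imp_primitives[OF X P _ _ _ K] Q R F by metis
    note iff = flat_conformal_killing_iff_constraints[OF P Q[rule_format] R[rule_format] *(1)
        F[rule_format, OF *(1)] *(2-5), THEN iffD1, OF K]
    show ?rhs
      unfolding c_def[symmetric] c' components
      by (rule exI[of _ f], rule exI[of _ h]) (use * iff in simp)
  next
    assume ?rhs
    then obtain f h where sf: "smooth_on UNIV f"
      and h: "\<forall>k. smooth_on upper_half_space (h k) \<and> indep_of_var_on upper_half_space (Some k) (h k)"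
      and XX: "\<forall>x\<in>upper_half_space.
        (\<forall>k. X x $ Some k = F f k (first_coords x) + c * Q k x + c * R k x + h k x) \<and>
        X x $ None = x $ None * f (first_coords x) + c * (x $ None * P x)"
      and C1: "\<forall>x\<in>upper_half_space. \<forall>k. partial None (h k) x =
        - (x $ None) * partial k f (first_coords x)
        + - c * (partial (Some k) (\<lambda>y. y $ None * P y) x + partial None (\<lambda>y. Q k y + R k y) x)"
      and C2: "\<forall>x\<in>upper_half_space. \<forall>k j. k \<noteq> j \<longrightarrow>
        partial j (F f k) (first_coords x) + partial k (F f j) (first_coords x)
          + partial (Some j) (h k) x + partial (Some k) (h j) x =
        - c * partial (Some j) (\<lambda>y. R k y + Q k y) x + - c * partial (Some k) (\<lambda>y. R j y + Q j y) x"
      unfolding c_def[symmetric] c' components by (elim exE conjE) (rule that)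
    show "flat_conformal_killing_on upper_half_space X (\<lambda>x. X x $ None / x $ None + c / G x)"
      by (rule flat_conformal_killing_iff_constraints[OF P Q[rule_format] R[rule_format] sf
          F[rule_format, OF sf], THEN iffD2, of h]) (use h XX C1 C2 in simp_all)
  qed
qed

end
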